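(* Let $\mathcal{X}$ be an infinite dimensional separable complex Banach space and let $T$ be a bounded linear operator on $\mathcal{X}$. Let $A_T$ be the bounded linear operator on $\mathcal{X}\times\mathcal{X}$ given by $A_T(x,y)=(y,Tx)$. If $A_T^2$ has a nontrivial closed hyperinvariant subspace, then $T$ has a nontrivial closed invariant subspace.
   Context: $\mathcal{X}\times\mathcal{X}$ is the Banach space with norm $\|(x,y)\|=\|x\|+\|y\|$. In block form $A_T=\begin{bmatrix}0&I\\ T&0\end{bmatrix}$. A closed linear subspace is invariant for an operator if the operator maps it into itself; it is nontrivial if it is neither $\{0\}$ nor the whole space. A closed subspace is hyperinvariant for an operator $S$ if it is invariant under every bounded linear operator commuting with $S$. *)

theory Defs
  imports "HOL-Analysis.Analysis"
begin

section \<open>Complex Banach spaces\<close>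

text \<open>
  The distribution has only real normed spaces. A complex normed space is a real
  normed space with a complex scalar multiplication that extends the real one.
\<close>

class complex_vector = real_vector +
  fixes scaleC :: "complex \<Rightarrow> 'a \<Rightarrow> 'a" (infixr \<open>*\<^sub>C\<close> 75)
  assumes scaleC_of_real: "complex_of_real r *\<^sub>C x = r *\<^sub>R x"
    and scaleC_add_right: "a *\<^sub>C (x + y) = a *\<^sub>C x + a *\<^sub>C y"
    and scaleC_add_left: "(a + b) *\<^sub>C x = a *\<^sub>C x + b *\<^sub>C x"
    and scaleC_scaleC: "a *\<^sub>C (b *\<^sub>C x) = (a * b) *\<^sub>C x"
    and scaleC_one: "1 *\<^sub>C x = x"

class complex_normed_vector = complex_vector + real_normed_vector +
  assumes norm_scaleC: "norm (a *\<^sub>C x) = cmod a * norm x"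

class cbanach = complex_normed_vector + complete_space

subclass (in cbanach) banach ..

global_interpretation complex_vector:
  vector_space "scaleC :: complex \<Rightarrow> 'a \<Rightarrow> 'a::complex_vector"
  by unfold_locales
    (simp_all add: scaleC_add_right scaleC_add_left scaleC_scaleC scaleC_one)

definition infinite_dimensional :: "'a::complex_vector itself \<Rightarrow> bool" where
  "infinite_dimensional _ \<longleftrightarrow>
     \<not> (\<exists>B :: 'a set. finite B \<and> complex_vector.span B = UNIV)"

definition bounded_clinear ::
    "('a::complex_normed_vector \<Rightarrow> 'b::complex_normed_vector) \<Rightarrow> bool" where
  "bounded_clinear f \<longleftrightarrow>
     Vector_Spaces.linear scaleC scaleC f \<and> (\<exists>K. \<forall>x. norm (f x) \<le> norm x * K)"


section \<open>Invariant and hyperinvariant subspaces\<close>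

definition closed_csubspace :: "'a::complex_normed_vector set \<Rightarrow> bool" where
  "closed_csubspace M \<longleftrightarrow> complex_vector.subspace M \<and> closed M"

definition nontrivial_csubspace :: "'a::complex_normed_vector set \<Rightarrow> bool" where
  "nontrivial_csubspace M \<longleftrightarrow> M \<noteq> {0} \<and> M \<noteq> UNIV"

definition invariant_subspace ::
    "('a::complex_normed_vector \<Rightarrow> 'a) \<Rightarrow> 'a set \<Rightarrow> bool" where
  "invariant_subspace S M \<longleftrightarrow> closed_csubspace M \<and> S ` M \<subseteq> M"

definition hyperinvariant_subspace ::
    "('a::complex_normed_vector \<Rightarrow> 'a) \<Rightarrow> 'a set \<Rightarrow> bool" where
  "hyperinvariant_subspace S M \<longleftrightarrow> closed_csubspace M \<and>
     (\<forall>R. bounded_clinear R \<and> R \<circ> S = S \<circ> R \<longrightarrow> invariant_subspace R M)"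


section \<open>The product with the sum norm\<close>

text \<open>
  The library's product type carries the norm
  \<open>sqrt ((norm x)\<^sup>2 + (norm y)\<^sup>2)\<close>, so the product normed by
  \<open>norm x + norm y\<close> gets its own type.
\<close>

datatype ('a, 'b) sum_prod = SPair (sfst: 'a) (ssnd: 'b)

lemma sum_prod_eq_iff: "p = q \<longleftrightarrow> sfst p = sfst q \<and> ssnd p = ssnd q"
  by (cases p; cases q) simp

instantiation sum_prod :: (ab_group_add, ab_group_add) ab_group_add
begin

definition zero_sum_prod_def: "0 = SPair 0 0"
definition plus_sum_prod_def: "p + q = SPair (sfst p + sfst q) (ssnd p + ssnd q)"
definition minus_sum_prod_def: "p - q = SPair (sfst p - sfst q) (ssnd p - ssnd q)"
definition uminus_sum_prod_def: "- p = SPair (- sfst p) (- ssnd p)"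

instance
  by standard
    (simp_all add: sum_prod_eq_iff zero_sum_prod_def plus_sum_prod_def
      minus_sum_prod_def uminus_sum_prod_def algebra_simps)

end

lemma sum_prod_sel [simp]:
  "sfst 0 = 0" "ssnd 0 = 0"
  "sfst (p + q) = sfst p + sfst q" "ssnd (p + q) = ssnd p + ssnd q"
  "sfst (p - q) = sfst p - sfst q" "ssnd (p - q) = ssnd p - ssnd q"
  "sfst (- p) = - sfst p" "ssnd (- p) = - ssnd p"
  by (simp_all add: zero_sum_prod_def plus_sum_prod_def minus_sum_prod_def uminus_sum_prod_def)

instantiation sum_prod :: (complex_vector, complex_vector) complex_vector
begin

definition scaleR_sum_prod_def: "r *\<^sub>R p = SPair (r *\<^sub>R sfst p) (r *\<^sub>R ssnd p)"
definition scaleC_sum_prod_def: "a *\<^sub>C p = SPair (a *\<^sub>C sfst p) (a *\<^sub>C ssnd p)"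

instance
  by standard
    (simp_all add: sum_prod_eq_iff scaleR_sum_prod_def scaleC_sum_prod_def scaleC_of_real
      scaleC_add_right scaleC_add_left scaleC_scaleC scaleC_one
      scaleR_add_right scaleR_add_left)

end

lemma sum_prod_scale_sel [simp]:
  "sfst (r *\<^sub>R p) = r *\<^sub>R sfst p" "ssnd (r *\<^sub>R p) = r *\<^sub>R ssnd p"
  "sfst (a *\<^sub>C p) = a *\<^sub>C sfst p" "ssnd (a *\<^sub>C p) = a *\<^sub>C ssnd p"
  by (simp_all add: scaleR_sum_prod_def scaleC_sum_prod_def)

instantiation sum_prod :: (complex_normed_vector, complex_normed_vector) complex_normed_vector
begin

definition norm_sum_prod_def: "norm p = norm (sfst p) + norm (ssnd p)"
definition sgn_sum_prod_def: "sgn (p :: ('a, 'b) sum_prod) = inverse (norm p) *\<^sub>R p"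
definition dist_sum_prod_def: "dist p q = norm (p - q :: ('a, 'b) sum_prod)"
definition uniformity_sum_prod_def [code del]:
  "(uniformity :: (('a, 'b) sum_prod \<times> ('a, 'b) sum_prod) filter) =
     (INF e\<in>{0 <..}. principal {(p, q). dist p q < e})"
definition open_sum_prod_def [code del]:
  "open (U :: ('a, 'b) sum_prod set) \<longleftrightarrow>
     (\<forall>p\<in>U. eventually (\<lambda>(p', q). p' = p \<longrightarrow> q \<in> U) uniformity)"

instance
proof
  fix p q :: "('a, 'b) sum_prod" and r :: real and a :: complex and U :: "('a, 'b) sum_prod set"
  show "norm p = 0 \<longleftrightarrow> p = 0"
    by (simp add: norm_sum_prod_def sum_prod_eq_iff add_nonneg_eq_0_iff)
  show "norm (p + q) \<le> norm p + norm q"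
    using norm_triangle_ineq[of "sfst p" "sfst q"] norm_triangle_ineq[of "ssnd p" "ssnd q"]
    by (simp add: norm_sum_prod_def)
  show "norm (r *\<^sub>R p) = \<bar>r\<bar> * norm p"
    by (simp add: norm_sum_prod_def distrib_left)
  show "norm (a *\<^sub>C p) = cmod a * norm p"
    by (simp add: norm_sum_prod_def norm_scaleC distrib_left)
qed (rule sgn_sum_prod_def dist_sum_prod_def uniformity_sum_prod_def open_sum_prod_def)+

end

instance sum_prod :: (cbanach, cbanach) cbanach
proof
  fix X :: "nat \<Rightarrow> ('a, 'b) sum_prod"
  assume X: "Cauchy X"
  have "Cauchy (\<lambda>n. sfst (X n))"
  proof (rule metric_CauchyI)
    fix e :: real assume "0 < e"
    with X obtain M where "\<forall>m\<ge>M. \<forall>n\<ge>M. dist (X m) (X n) < e"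
      by (meson metric_CauchyD)
    moreover have "dist (sfst (X m)) (sfst (X n)) \<le> dist (X m) (X n)" for m n
      by (simp add: dist_norm norm_sum_prod_def)
    ultimately show "\<exists>M. \<forall>m\<ge>M. \<forall>n\<ge>M. dist (sfst (X m)) (sfst (X n)) < e"
      by (meson le_less_trans)
  qed
  then obtain x where x: "(\<lambda>n. sfst (X n)) \<longlonglongrightarrow> x"
    using Cauchy_convergent convergent_def by blast
  have "Cauchy (\<lambda>n. ssnd (X n))"
  proof (rule metric_CauchyI)
    fix e :: real assume "0 < e"
    with X obtain M where "\<forall>m\<ge>M. \<forall>n\<ge>M. dist (X m) (X n) < e"
      by (meson metric_CauchyD)
    moreover have "dist (ssnd (X m)) (ssnd (X n)) \<le> dist (X m) (X n)" for m n
      by (simp add: dist_norm norm_sum_prod_def)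
    ultimately show "\<exists>M. \<forall>m\<ge>M. \<forall>n\<ge>M. dist (ssnd (X m)) (ssnd (X n)) < e"
      by (meson le_less_trans)
  qed
  then obtain y where y: "(\<lambda>n. ssnd (X n)) \<longlonglongrightarrow> y"
    using Cauchy_convergent convergent_def by blast
  have "(\<lambda>n. norm (sfst (X n) - x) + norm (ssnd (X n) - y)) \<longlonglongrightarrow> 0 + 0"
    using x y by (intro tendsto_add) (simp_all add: LIM_zero tendsto_norm_zero)
  then have "(\<lambda>n. dist (X n) (SPair x y)) \<longlonglongrightarrow> 0"
    by (simp add: dist_norm norm_sum_prod_def)
  then have "X \<longlonglongrightarrow> SPair x y"
    by (rule iffD2[OF tendsto_dist_iff])
  then show "convergent X"
    by (rule convergentI)
qed


section \<open>The block operator\<close>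

definition block_op ::
    "('a::cbanach \<Rightarrow> 'a) \<Rightarrow> ('a, 'a) sum_prod \<Rightarrow> ('a, 'a) sum_prod" where
  "block_op T p = SPair (ssnd p) (T (sfst p))"

lemma bounded_clinear_block_op:
  assumes "bounded_clinear T"
  shows "bounded_clinear (block_op T)"
proof -
  interpret T: Vector_Spaces.linear scaleC scaleC T
    using assms by (simp add: bounded_clinear_def)
  obtain K where K: "\<And>x. norm (T x) \<le> norm x * K"
    using assms by (auto simp: bounded_clinear_def)
  have "Vector_Spaces.linear scaleC scaleC (block_op T)"
    by unfold_locales
      (simp_all add: block_op_def sum_prod_eq_iff T.add T.scale)
  moreover have "norm (block_op T p) \<le> norm p * (1 + \<bar>K\<bar>)" for p
  proof -
    have "norm (T (sfst p)) \<le> norm (sfst p) * \<bar>K\<bar>"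
      using K[of "sfst p"] by (meson abs_ge_self mult_left_mono norm_ge_zero order_trans)
    moreover have "0 \<le> norm (ssnd p) * \<bar>K\<bar>"
      by simp
    ultimately have "norm (ssnd p) + norm (T (sfst p))
        \<le> norm (sfst p) + norm (ssnd p) + norm (sfst p) * \<bar>K\<bar> + norm (ssnd p) * \<bar>K\<bar>"
      using norm_ge_zero[of "sfst p"] by linarith
    then show ?thesis
      by (simp add: block_op_def norm_sum_prod_def algebra_simps)
  qed
  ultimately show ?thesis
    unfolding bounded_clinear_def by blast
qed

end

theory Submission
  imports Defs
begin

text \<open>
  The square of the block operator is diagonal: it is \<open>T \<oplus> T\<close>. It therefore commutes
  with every operator given by a scalar \<open>2 \<times> 2\<close> matrix, and a subspace \<open>M\<close> that is
  invariant under all these matrices splits as \<open>N \<oplus> N\<close>: the matrix units move any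
  coordinate of a vector of \<open>M\<close> to any position and replace the other coordinate by
  zero (\<open>scalar_matrix_invariant_splits\<close>). Such an \<open>M\<close> is trivial exactly when \<open>N\<close>
  is, and \<open>T \<oplus> T\<close>, which commutes with itself, maps \<open>N \<oplus> N\<close> into itself exactly
  when \<open>T\<close> maps \<open>N\<close> into itself.
\<close>

lemma bounded_clinear_compose:
  assumes "bounded_clinear f" and "bounded_clinear g"
  shows "bounded_clinear (f \<circ> g)"
proof -
  interpret f: Vector_Spaces.linear scaleC scaleC f
    using assms by (simp add: bounded_clinear_def)
  interpret g: Vector_Spaces.linear scaleC scaleC g
    using assms by (simp add: bounded_clinear_def)
  obtain K where K: "\<And>x. norm (f x) \<le> norm x * K"
    using assms by (auto simp: bounded_clinear_def)
  obtain L where L: "\<And>x. norm (g x) \<le> norm x * L"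
    using assms by (auto simp: bounded_clinear_def)
  have "norm ((f \<circ> g) x) \<le> norm x * (L * \<bar>K\<bar>)" for x
  proof -
    have "norm ((f \<circ> g) x) \<le> norm (g x) * \<bar>K\<bar>"
      using K[of "g x"] by (simp add: order_trans[OF _ mult_left_mono])
    also have "\<dots> \<le> norm x * L * \<bar>K\<bar>"
      using L[of x] by (intro mult_right_mono) auto
    finally show ?thesis
      by (simp add: mult.assoc)
  qed
  moreover have "Vector_Spaces.linear scaleC scaleC (f \<circ> g)"
    by unfold_locales (simp_all add: f.add f.scale g.add g.scale)
  ultimately show ?thesis
    unfolding bounded_clinear_def by blast
qed

lemma block_op_square: "(block_op T ^^ 2) p = SPair (T (sfst p)) (T (ssnd p))"
  by (simp add: block_op_def numeral_2_eq_2)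

definition scalar_matrix_op ::
    "complex \<Rightarrow> complex \<Rightarrow> complex \<Rightarrow> complex \<Rightarrow>
      ('a::complex_normed_vector, 'a) sum_prod \<Rightarrow> ('a, 'a) sum_prod" where
  "scalar_matrix_op a b c d p =
     SPair (a *\<^sub>C sfst p + b *\<^sub>C ssnd p) (c *\<^sub>C sfst p + d *\<^sub>C ssnd p)"

lemma bounded_clinear_scalar_matrix_op: "bounded_clinear (scalar_matrix_op a b c d)"
proof -
  let ?S = "cmod a + cmod b + cmod c + cmod d"
  have "norm (scalar_matrix_op a b c d p) \<le> norm p * ?S" for p
  proof -
    have "norm (scalar_matrix_op a b c d p)
        \<le> (cmod a + cmod c) * norm (sfst p) + (cmod b + cmod d) * norm (ssnd p)"
      using norm_triangle_ineq[of "a *\<^sub>C sfst p" "b *\<^sub>C ssnd p"]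
        norm_triangle_ineq[of "c *\<^sub>C sfst p" "d *\<^sub>C ssnd p"]
      by (simp add: scalar_matrix_op_def norm_sum_prod_def norm_scaleC algebra_simps)
    also have "\<dots> \<le> ?S * norm (sfst p) + ?S * norm (ssnd p)"
      by (rule add_mono; rule mult_right_mono) auto
    finally show ?thesis
      by (simp add: norm_sum_prod_def algebra_simps)
  qed
  moreover have "Vector_Spaces.linear scaleC scaleC (scalar_matrix_op a b c d)"
    by unfold_locales
      (simp_all add: scalar_matrix_op_def sum_prod_eq_iff scaleC_add_right scaleC_scaleC
        mult.commute)
  ultimately show ?thesis
    unfolding bounded_clinear_def by blast
qed

text \<open>
  The square acts as \<open>T\<close> in each coordinate separately, and a linear \<open>T\<close> respects the
  linear combinations of coordinates that the matrix forms.
\<close>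

lemma scalar_matrix_op_commutes_block_op_square:
  assumes "Vector_Spaces.linear scaleC scaleC T"
  shows "scalar_matrix_op a b c d \<circ> (block_op T ^^ 2)
    = (block_op T ^^ 2) \<circ> scalar_matrix_op a b c d"
proof -
  interpret T: Vector_Spaces.linear scaleC scaleC T by fact
  show ?thesis
    by (simp add: fun_eq_iff block_op_square scalar_matrix_op_def T.add T.scale)
qed

text \<open>
  Three matrix units suffice. One projects to the first summand and one moves the second
  coordinate there; conversely, a third moves it back, and the two parts add up to \<open>p\<close>.
\<close>

lemma scalar_matrix_invariant_splits:
  assumes M: "complex_vector.subspace M"
    and inv: "\<And>a b c d p. p \<in> M \<Longrightarrow> scalar_matrix_op a b c d p \<in> M"
  shows "p \<in> M \<longleftrightarrow> SPair (sfst p) 0 \<in> M \<and> SPair (ssnd p) 0 \<in> M"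
proof
  assume p: "p \<in> M"
  show "SPair (sfst p) 0 \<in> M \<and> SPair (ssnd p) 0 \<in> M"
    using inv[OF p, of 1 0 0 0] inv[OF p, of 0 1 0 0]
    by (simp add: scalar_matrix_op_def scaleC_one)
next
  assume *: "SPair (sfst p) 0 \<in> M \<and> SPair (ssnd p) 0 \<in> M"
  have "SPair 0 (ssnd p) \<in> M"
    using inv[of "SPair (ssnd p) 0" 0 0 1 0] * by (simp add: scalar_matrix_op_def scaleC_one)
  then have "SPair (sfst p) 0 + SPair 0 (ssnd p) \<in> M"
    using * M by (blast intro: complex_vector.subspace_add)
  then show "p \<in> M"
    by (simp add: plus_sum_prod_def)
qed

text \<open>
  The set is the preimage of \<open>M\<close> under the linear isometry that embeds the first summand.
\<close>

lemma closed_csubspace_first_summand: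
  fixes M :: "('a::complex_normed_vector, 'b::complex_normed_vector) sum_prod set"
  assumes "closed_csubspace M"
  shows "closed_csubspace {x. SPair x 0 \<in> M}"
proof -
  have sub: "complex_vector.subspace M" and "closed M"
    using assms by (auto simp: closed_csubspace_def)
  have "continuous_on UNIV (\<lambda>x :: 'a. SPair x (0 :: 'b))"
    unfolding continuous_on_iff by (auto simp: dist_norm norm_sum_prod_def)
  then have "closed ((\<lambda>x. SPair x 0) -` M)"
    using \<open>closed M\<close> by (simp add: continuous_on_closed_vimage)
  moreover have "complex_vector.subspace {x. SPair x 0 \<in> M}"
  proof (rule complex_vector.subspaceI)
    show "0 \<in> {x. SPair x 0 \<in> M}"
      using complex_vector.subspace_0[OF sub] by (simp add: zero_sum_prod_def)
    show "x + y \<in> {x. SPair x 0 \<in> M}"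
      if "x \<in> {x. SPair x 0 \<in> M}" "y \<in> {x. SPair x 0 \<in> M}" for x y
      using complex_vector.subspace_add[OF sub, of "SPair x 0" "SPair y 0"] that
      by (simp add: plus_sum_prod_def)
    show "c *\<^sub>C x \<in> {x. SPair x 0 \<in> M}" if "x \<in> {x. SPair x 0 \<in> M}" for c x
      using complex_vector.subspace_scale[OF sub, of "SPair x 0" c] that
      by (simp add: scaleC_sum_prod_def)
  qed
  ultimately show ?thesis
    by (simp add: closed_csubspace_def vimage_def)
qed

theorem corollary3p2:
  fixes T :: "'a::cbanach \<Rightarrow> 'a"
  assumes "infinite_dimensional TYPE('a)"
    and "separable_space (euclidean :: 'a topology)"
    and "bounded_clinear T"
    and "\<exists>M. nontrivial_csubspace M \<and> hyperinvariant_subspace (block_op T ^^ 2) M"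
  shows "\<exists>N. nontrivial_csubspace N \<and> invariant_subspace T N"
proof -
  obtain M where nontriv: "nontrivial_csubspace M"
    and hyper: "hyperinvariant_subspace (block_op T ^^ 2) M"
    using assms(4) by blast
  interpret T: Vector_Spaces.linear scaleC scaleC T
    using assms(3) by (simp add: bounded_clinear_def)
  define N where "N = {x. SPair x 0 \<in> M}"
  have M: "closed_csubspace M"
    using hyper by (simp add: hyperinvariant_subspace_def)
  have commutant: "R p \<in> M"
    if "bounded_clinear R" "R \<circ> (block_op T ^^ 2) = (block_op T ^^ 2) \<circ> R" "p \<in> M" for R p
    using hyper that unfolding hyperinvariant_subspace_def invariant_subspace_def by blast
  have "scalar_matrix_op a b c d p \<in> M" if "p \<in> M" for a b c d p
    by (rule commutant[OF bounded_clinear_scalar_matrix_op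
          scalar_matrix_op_commutes_block_op_square[OF T.linear_axioms] that])
  then have splits: "p \<in> M \<longleftrightarrow> sfst p \<in> N \<and> ssnd p \<in> N" for p
    using scalar_matrix_invariant_splits[of M p] M by (simp add: closed_csubspace_def N_def)
  have "bounded_clinear (block_op T ^^ 2)"
    using bounded_clinear_compose[OF bounded_clinear_block_op[OF assms(3)]
        bounded_clinear_block_op[OF assms(3)]]
    by (simp add: numeral_2_eq_2)
  then have square_inv: "(block_op T ^^ 2) p \<in> M" if "p \<in> M" for p
    by (rule commutant[OF _ refl that])
  have "T x \<in> N" if "x \<in> N" for x
    using square_inv[of "SPair x x"] that by (simp add: splits block_op_square)
  then have "T ` N \<subseteq> N"
    by blast
  moreover have "closed_csubspace N"
    using closed_csubspace_first_summand[OF M] by (simp add: N_def)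
  moreover have "nontrivial_csubspace N"
  proof -
    have "M = {0}" if "N = {0}"
      unfolding set_eq_iff splits that by (simp add: sum_prod_eq_iff[of _ 0])
    moreover have "M = UNIV" if "N = UNIV"
      unfolding set_eq_iff splits that by simp
    ultimately show ?thesis
      using nontriv unfolding nontrivial_csubspace_def by blast
  qed
  ultimately show ?thesis
    unfolding invariant_subspace_def by blast
qed

end
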